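(* Let $\mathcal A$ be a finite set of $m\ge2$ alternatives, $n\ge2$, $0<\varphi<1$, and consider Condorcet's model with dispersion $\varphi$ and $n$ i.i.d. samples. Let $a\in\mathcal A$, $H_0=R_{a\succ\text{others}}$, and $H_1\subseteq\mathcal B(\mathcal A)\setminus H_0$. Then there exists a level-$\alpha$ UMP test for $H_0$ vs. $H_1$ for every $0<\alpha<1$ if and only if there exists $B\subseteq\mathcal A\setminus\{a\}$ such that $H_1\subseteq R_{B\succ a}$. Moreover, when $H_1\subseteq R_{B\succ a}$, for every $0<\alpha<1$ the following test is a level-$\alpha$ UMP test for $H_0$ vs. $H_1$: for every $n$-profile $P_n\in\mathcal B(\mathcal A)^n$, $$g_{\alpha,a,B}(P_n)=\begin{cases}1&\text{if }w_{P_n}(B\succ a)>K_\alpha\\ 0&\text{if }w_{P_n}(B\succ a)<K_\alpha\\ \Gamma_\alpha&\text{if }w_{P_n}(B\succ a)=K_\alpha,\end{cases}$$ where $K_\alpha\in\mathbb R$ and $\Gamma_\alpha\in[0,1]$ are chosen such that the size of $g_{\alpha,a,B}$ is $\alpha$.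
   Context: $\mathcal B(\mathcal A)$ is the set of all irreflexive, antisymmetric, total binary relations over $\mathcal A$ (for each pair of distinct alternatives exactly one is preferred to the other; transitivity is not required); $b\succ_V c$ means $b$ is preferred to $c$ in $V$. $R_{a\succ\text{others}}=\{V\in\mathcal B(\mathcal A): a\succ_V b\text{ for all }b\ne a\}$. For $B\subseteq\mathcal A\setminus\{a\}$, $R_{B\succ a}$ is the set of all relations in $\mathcal B(\mathcal A)$ in which the set of alternatives preferred to $a$ is exactly $B$. $\mathrm{KT}(V,W)$ is the number of unordered pairs of alternatives on which $V,W\in\mathcal B(\mathcal A)$ disagree. Condorcet's model with fixed dispersion $\varphi$: sample space $\mathcal B(\mathcal A)^n$, parameter space $\mathcal B(\mathcal A)$; given parameter $W$, the $n$ relations are i.i.d. with $\pi_W(V)=\frac1Z\varphi^{\mathrm{KT}(V,W)}$, $Z$ the normalization factor. For a profile $P$, $P(b\succ c)$ is the number of votes in $P$ in which $b$ is preferred to $c$; $w_P(b\succ c)=P(b\succ c)-P(c\succ b)$; $w_P(B\succ a)=\sum_{b\in B}w_P(b\succ a)$. Testing: for disjoint sets of parameters $H_0,H_1$, a (randomized) test is a function $f$ from the sample space to $[0,1]$ ($f(P)$ is the probability of rejecting $H_0$). $\mathrm{Size}(f,h_0)=E_{P\sim\pi_{h_0}}f(P)$, $\mathrm{Size}(f)=\sup_{h_0\in H_0}\mathrm{Size}(f,h_0)$, and $\mathrm{Power}(f,h_1)=E_{P\sim\pi_{h_1}}f(P)$ for $h_1\in H_1$. A level-$\alpha$ uniformly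 most powerful (UMP) test for $H_0$ vs. $H_1$ is a test $f$ with $\mathrm{Size}(f)=\alpha$ such that for every $h_1\in H_1$ and every test $g$ with $\mathrm{Size}(g)\le\alpha$, $\mathrm{Power}(f,h_1)\ge\mathrm{Power}(g,h_1)$. *)

theory Defs
  imports "HOL-Probability.Probability"
begin

text \<open>A relation \<open>V\<close> over \<open>A\<close> is a set of pairs; \<open>(b, c) \<in> V\<close> means that \<open>b\<close> is preferred to \<open>c\<close>
  in \<open>V\<close>. Transitivity is not required.\<close>

definition binrels :: "'a set \<Rightarrow> 'a rel set" where
  "binrels A = {V. V \<subseteq> A \<times> A \<and> irrefl V \<and> antisym V \<and> total_on A V}"

definition rels_top :: "'a set \<Rightarrow> 'a \<Rightarrow> 'a rel set" where
  "rels_top A a = {V \<in> binrels A. \<forall>b \<in> A - {a}. (a, b) \<in> V}"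

definition rels_above :: "'a set \<Rightarrow> 'a set \<Rightarrow> 'a \<Rightarrow> 'a rel set" where
  "rels_above A B a = {V \<in> binrels A. {b \<in> A. (b, a) \<in> V} = B}"

definition KT :: "'a set \<Rightarrow> 'a rel \<Rightarrow> 'a rel \<Rightarrow> nat" where
  "KT A V W = card {{b, c} | b c. b \<in> A \<and> c \<in> A \<and> b \<noteq> c \<and> ((b, c) \<in> V) \<noteq> ((b, c) \<in> W)}"

definition condorcet_Z :: "'a set \<Rightarrow> real \<Rightarrow> 'a rel \<Rightarrow> real" where
  "condorcet_Z A \<phi> W = (\<Sum>V \<in> binrels A. \<phi> ^ KT A V W)"

definition condorcet_pmf :: "'a set \<Rightarrow> real \<Rightarrow> 'a rel \<Rightarrow> 'a rel pmf" where
  "condorcet_pmf A \<phi> W =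
     embed_pmf (\<lambda>V. if V \<in> binrels A then \<phi> ^ KT A V W / condorcet_Z A \<phi> W else 0)"

text \<open>An \<open>n\<close>-profile is a list of \<open>n\<close> relations; \<^const>\<open>replicate_pmf\<close> is the law of \<open>n\<close> i.i.d. draws.\<close>

definition profiles :: "'a set \<Rightarrow> nat \<Rightarrow> 'a rel list set" where
  "profiles A n = {P. set P \<subseteq> binrels A \<and> length P = n}"

definition condorcet_model :: "'a set \<Rightarrow> real \<Rightarrow> nat \<Rightarrow> 'a rel \<Rightarrow> 'a rel list pmf" where
  "condorcet_model A \<phi> n W = replicate_pmf n (condorcet_pmf A \<phi> W)"

text \<open>\<^const>\<open>embed_pmf\<close> is only meaningful for a genuine probability mass function; the lemmas below
  establish that \<^const>\<open>condorcet_pmf\<close> has the intended masses.\<close>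

lemma finite_binrels: "finite A \<Longrightarrow> finite (binrels A)"
  by (rule finite_subset[of _ "Pow (A \<times> A)"]) (auto simp: binrels_def)

lemma binrels_nonempty:
  assumes "finite A"
  shows "binrels A \<noteq> {}"
proof -
  obtain f :: "'a \<Rightarrow> nat" where f: "inj_on f A"
    using finite_imp_inj_to_nat_seg[OF assms] by blast
  have "{(x, y). x \<in> A \<and> y \<in> A \<and> f x < f y} \<in> binrels A"
    using f unfolding binrels_def
    by (auto simp: irrefl_def antisym_def total_on_def inj_on_def) (metis nat_neq_iff)
  thus ?thesis by blast
qed

lemma condorcet_Z_pos:
  assumes "finite A" "0 < \<phi>"
  shows "0 < condorcet_Z A \<phi> W"
  unfolding condorcet_Z_def
  using assms finite_binrels binrels_nonempty by (intro sum_pos) auto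

lemma pmf_condorcet_pmf:
  assumes "finite A" "0 < \<phi>"
  shows "pmf (condorcet_pmf A \<phi> W) V =
    (if V \<in> binrels A then \<phi> ^ KT A V W / condorcet_Z A \<phi> W else 0)"
proof -
  let ?f = "\<lambda>V. if V \<in> binrels A then \<phi> ^ KT A V W / condorcet_Z A \<phi> W else 0"
  have Z: "0 < condorcet_Z A \<phi> W" by (rule condorcet_Z_pos[OF assms])
  have nonneg: "0 \<le> ?f V" for V using Z assms by simp
  have "(\<integral>\<^sup>+V. ennreal (?f V) \<partial>count_space UNIV) = (\<Sum>V \<in> binrels A. ennreal (?f V))"
    by (rule nn_integral_count_space'[OF finite_binrels[OF assms(1)]]) auto
  also have "\<dots> = ennreal (\<Sum>V \<in> binrels A. ?f V)"
    by (rule sum_ennreal) (rule nonneg)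
  also have "(\<Sum>V \<in> binrels A. ?f V) = 1"
    using Z by (simp add: condorcet_Z_def flip: sum_divide_distrib)
  finally show ?thesis
    unfolding condorcet_pmf_def using nonneg by (subst pmf_embed_pmf) auto
qed

lemma set_pmf_condorcet_model:
  assumes "finite A" "0 < \<phi>"
  shows "set_pmf (condorcet_model A \<phi> n W) = profiles A n"
proof -
  have "set_pmf (condorcet_pmf A \<phi> W) = binrels A"
    using assms condorcet_Z_pos[OF assms, of W]
    by (auto simp: set_pmf_eq pmf_condorcet_pmf split: if_splits)
  thus ?thesis
    by (auto simp: condorcet_model_def profiles_def set_replicate_pmf)
qed

definition votes :: "'a rel list \<Rightarrow> 'a \<Rightarrow> 'a \<Rightarrow> nat" where
  "votes P b c = length (filter (\<lambda>V. (b, c) \<in> V) P)"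

definition margin :: "'a rel list \<Rightarrow> 'a \<Rightarrow> 'a \<Rightarrow> int" where
  "margin P b c = int (votes P b c) - int (votes P c b)"

definition set_margin :: "'a rel list \<Rightarrow> 'a set \<Rightarrow> 'a \<Rightarrow> int" where
  "set_margin P B a = (\<Sum>b \<in> B. margin P b a)"

text \<open>\<open>X\<close> is the sample space and \<open>\<pi>\<close> maps each parameter to a distribution supported in \<open>X\<close>;
  values of a test outside \<open>X\<close> are irrelevant.\<close>

definition is_test :: "'x set \<Rightarrow> ('x \<Rightarrow> real) \<Rightarrow> bool" where
  "is_test X f \<longleftrightarrow> (\<forall>x \<in> X. f x \<in> {0..1})"

definition test_size_at :: "('p \<Rightarrow> 'x pmf) \<Rightarrow> ('x \<Rightarrow> real) \<Rightarrow> 'p \<Rightarrow> real" where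
  "test_size_at \<pi> f h0 = measure_pmf.expectation (\<pi> h0) f"

definition test_size :: "('p \<Rightarrow> 'x pmf) \<Rightarrow> 'p set \<Rightarrow> ('x \<Rightarrow> real) \<Rightarrow> real" where
  "test_size \<pi> H0 f = (SUP h0 \<in> H0. test_size_at \<pi> f h0)"

definition test_power :: "('p \<Rightarrow> 'x pmf) \<Rightarrow> ('x \<Rightarrow> real) \<Rightarrow> 'p \<Rightarrow> real" where
  "test_power \<pi> f h1 = measure_pmf.expectation (\<pi> h1) f"

definition ump_test ::
  "'x set \<Rightarrow> ('p \<Rightarrow> 'x pmf) \<Rightarrow> 'p set \<Rightarrow> 'p set \<Rightarrow> real \<Rightarrow> ('x \<Rightarrow> real) \<Rightarrow> bool" where
  "ump_test X \<pi> H0 H1 \<alpha> f \<longleftrightarrow>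
     is_test X f \<and> test_size \<pi> H0 f = \<alpha> \<and>
     (\<forall>h1 \<in> H1. \<forall>g. is_test X g \<and> test_size \<pi> H0 g \<le> \<alpha> \<longrightarrow>
        test_power \<pi> f h1 \<ge> test_power \<pi> g h1)"

definition margin_test :: "real \<Rightarrow> real \<Rightarrow> 'a \<Rightarrow> 'a set \<Rightarrow> 'a rel list \<Rightarrow> real" where
  "margin_test K \<Gamma> a B P =
     (if real_of_int (set_margin P B a) > K then 1
      else if real_of_int (set_margin P B a) < K then 0
      else \<Gamma>)"

end

theory Submission
  imports Defs
begin

text \<open>
  The theorem rests on one likelihood ratio. In Condorcet's model a vote's probability decays
  geometrically in its number of disagreements with the true relation. Take a relation \<open>h\<close> in
  which exactly \<open>B\<close> is above \<open>a\<close>, and the null hypothesis \<open>h0\<close> obtained by raising \<open>a\<close> to the top and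
  keeping all other pairs. The disagreements on the other pairs cancel, and the likelihood ratio of
  \<open>h\<close> to \<open>h0\<close> at a profile with margin \<open>w\<close> of \<open>B\<close> over \<open>a\<close> is \<open>\<phi> powr (- w)\<close>
  (\<open>likelihood_ratio\<close>). Since \<open>\<phi> < 1\<close> this increases in \<open>w\<close>, so the margin test is the
  Neyman-Pearson test of \<open>h0\<close> against \<open>h\<close>.

  The pairing \<open>h0\<close> depends on \<open>h\<close>, but the test does not. The law of the margin is the same under
  all of \<open>H0\<close>: two members of \<open>H0\<close> differ only in pairs avoiding \<open>a\<close>, and reversing those pairs in
  every vote carries one model to the other without affecting comparisons with \<open>a\<close>
  (\<open>expectation_margin_const\<close>). Hence the size over \<open>H0\<close> is the size at \<open>h0\<close>, and a single margin
  test is optimal for every \<open>h\<close> with upper set \<open>B\<close>, against every competitor whose size over \<open>H0\<close> is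
  no larger (\<open>margin_test_neyman_pearson\<close>).

  For the converse, the equality case of the Neyman-Pearson lemma says that a uniformly most
  powerful test must agree with the margin test of every upper set occurring in \<open>H1\<close>, except on ties.
  If two upper sets \<open>B1\<close>, \<open>B2\<close> occur with \<open>B2\<close> not contained in \<open>B1\<close>, these demands conflict at
  the level where the test for \<open>B1\<close> rejects exactly the profiles with maximal margin of \<open>B1\<close>: two
  profiles are then ordered oppositely by the two margins (\<open>no_ump_of_distinct_upper_sets\<close>). This
  uses two votes; with \<open>n = 1\<close>, \<open>B1 = {b}\<close> and \<open>B2 = {b, c}\<close>, the two profiles would have equal
  margins of \<open>B2\<close>.
\<close>

section \<open>The Neyman-Pearson lemma on a finite sample space\<close>

lemma expectation_finite_support:
  fixes f :: "'x \<Rightarrow> real"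
  assumes "finite X" and "set_pmf p \<subseteq> X"
  shows "measure_pmf.expectation p f = (\<Sum>x\<in>X. f x * pmf p x)"
  using assms by (intro integral_measure_pmf_real) auto

text \<open>Pointwise, \<open>(s - f) (p1 - c p0)\<close> is nonnegative, because \<open>s\<close> is extreme in the direction
  of the sign of \<open>p1 - c p0\<close>; summing gives optimality. If the sum vanishes, then so does every
  term, which is why an optimal \<open>f\<close> must agree with \<open>s\<close> off the tie set.\<close>

lemma neyman_pearson:
  fixes p0 p1 :: "'x pmf" and c :: real
  assumes fin: "finite X" and supp: "set_pmf p0 \<subseteq> X" "set_pmf p1 \<subseteq> X"
    and c: "0 \<le> c"
    and f: "is_test X f"
    and reject: "\<And>x. x \<in> X \<Longrightarrow> pmf p1 x > c * pmf p0 x \<Longrightarrow> s x = 1"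
    and accept: "\<And>x. x \<in> X \<Longrightarrow> pmf p1 x < c * pmf p0 x \<Longrightarrow> s x = 0"
    and size: "measure_pmf.expectation p0 f \<le> measure_pmf.expectation p0 s"
  shows "measure_pmf.expectation p1 f \<le> measure_pmf.expectation p1 s" (is ?optimal)
    and "measure_pmf.expectation p1 s \<le> measure_pmf.expectation p1 f \<Longrightarrow>
           x \<in> X \<Longrightarrow> pmf p1 x \<noteq> c * pmf p0 x \<Longrightarrow> f x = s x"
proof -
  define t where "t x = (s x - f x) * (pmf p1 x - c * pmf p0 x)" for x
  have f01: "0 \<le> f x" "f x \<le> 1" if "x \<in> X" for x
    using f that by (auto simp: is_test_def)
  have nonneg: "0 \<le> t x" if x: "x \<in> X" for x
  proof -
    consider "pmf p1 x > c * pmf p0 x" | "pmf p1 x < c * pmf p0 x" | "pmf p1 x = c * pmf p0 x"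
      by linarith
    then show ?thesis
      using reject[OF x] accept[OF x] f01[OF x]
      by cases (auto simp: t_def mult_nonneg_nonpos)
  qed
  have sum_t: "(\<Sum>x\<in>X. t x) =
      (measure_pmf.expectation p1 s - measure_pmf.expectation p1 f)
      - c * (measure_pmf.expectation p0 s - measure_pmf.expectation p0 f)"
    unfolding expectation_finite_support[OF fin supp(1)] expectation_finite_support[OF fin supp(2)]
      t_def
    by (simp add: algebra_simps sum_subtractf sum.distrib sum_distrib_left)
  have gain: "0 \<le> c * (measure_pmf.expectation p0 s - measure_pmf.expectation p0 f)"
    using c size by simp
  have sum_nonneg: "0 \<le> (\<Sum>x\<in>X. t x)"
    using nonneg by (intro sum_nonneg) auto
  show ?optimal using sum_t gain sum_nonneg by linarith
  show "f x = s x" if "measure_pmf.expectation p1 s \<le> measure_pmf.expectation p1 f"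
    and x: "x \<in> X" and neq: "pmf p1 x \<noteq> c * pmf p0 x"
  proof -
    have "(\<Sum>x\<in>X. t x) = 0"
      using that(1) sum_t gain sum_nonneg by linarith
    then have "t x = 0"
      using sum_nonneg_eq_0_iff[of X t] fin nonneg x by blast
    then show ?thesis using neq by (simp add: t_def)
  qed
qed

text \<open>The threshold is the largest attained value \<open>K\<close> whose upper tail, atom included, still has
  mass at least \<open>\<alpha>\<close>; the tail without the atom then has mass at most \<open>\<alpha>\<close>, and randomizing on
  the atom interpolates between the two.\<close>

lemma exists_randomized_threshold:
  fixes p :: "'x pmf" and Y :: "'x \<Rightarrow> real" and \<alpha> :: real
  assumes fin: "finite (set_pmf p)" and \<alpha>: "0 < \<alpha>" "\<alpha> \<le> 1"
  shows "\<exists>K \<Gamma>. \<Gamma> \<in> {0..1} \<and>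
    measure_pmf.expectation p (\<lambda>x. if Y x > K then 1 else if Y x < K then 0 else \<Gamma>) = \<alpha>"
proof -
  define S where "S = Y ` set_pmf p"
  define T where "T = {k \<in> S. \<alpha> \<le> measure_pmf.prob p {x. k \<le> Y x}}"
  have S: "finite S" "S \<noteq> {}"
    using fin by (auto simp: S_def set_pmf_not_empty)
  have "measure_pmf.prob p {x. Min S \<le> Y x} = 1"
    using S by (intro measure_pmf.prob_eq_1[THEN iffD2]) (auto simp: AE_measure_pmf_iff S_def)
  then have "Min S \<in> T"
    using S \<alpha> by (auto simp: T_def)
  moreover have "finite T"
    using S by (simp add: T_def)
  ultimately have T: "finite T" "T \<noteq> {}" by auto
  define K where "K = Max T"
  have "K \<in> T" unfolding K_def by (rule Max_in[OF T])
  then have K: "K \<in> S" "\<alpha> \<le> measure_pmf.prob p {x. K \<le> Y x}"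
    by (auto simp: T_def)
  define u where "u = measure_pmf.prob p {x. K < Y x}"
  define v where "v = measure_pmf.prob p {x. Y x = K}"
  have "measure_pmf.prob p {x. K \<le> Y x} = measure_pmf.prob p ({x. K < Y x} \<union> {x. Y x = K})"
    by (rule arg_cong[where f = "measure_pmf.prob p"]) auto
  also have "\<dots> = u + v"
    unfolding u_def v_def by (rule measure_pmf.finite_measure_Union) auto
  finally have uv: "\<alpha> \<le> u + v" using K by simp
  have u: "u \<le> \<alpha>"
  proof (rule ccontr)
    assume "\<not> u \<le> \<alpha>"
    then have big: "\<alpha> < u" by simp
    define U where "U = {k \<in> S. K < k}"
    have "U \<noteq> {}"
    proof
      assume "U = {}"
      then have "set_pmf p \<inter> {x. K < Y x} = {}" by (auto simp: U_def S_def)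
      then have "u = 0"
        unfolding u_def by (simp add: measure_pmf_zero_iff)
      then show False using big \<alpha> by simp
    qed
    moreover have "finite U" using S by (simp add: U_def)
    ultimately have m: "Min U \<in> U" "\<And>k. k \<in> U \<Longrightarrow> Min U \<le> k" by auto
    have "u = measure_pmf.prob p {x. Min U \<le> Y x}"
      unfolding u_def
    proof (rule measure_pmf.finite_measure_eq_AE)
      have "K < Y x \<longleftrightarrow> Min U \<le> Y x" if "x \<in> set_pmf p" for x
        using m(1) m(2)[of "Y x"] that by (auto simp: U_def S_def)
      then show "AE x in measure_pmf p. (x \<in> {x. K < Y x}) = (x \<in> {x. Min U \<le> Y x})"
        by (simp add: AE_measure_pmf_iff)
    qed auto
    then have "Min U \<in> T" using m(1) big by (auto simp: T_def U_def)
    then have "Min U \<le> K" unfolding K_def using T by (intro Max_ge)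
    then show False using m(1) by (simp add: U_def)
  qed
  have "0 < v"
    using K(1) unfolding v_def S_def by (auto intro!: measure_pmf_posI)
  define \<Gamma> where "\<Gamma> = (\<alpha> - u) / v"
  have \<Gamma>: "\<Gamma> \<in> {0..1}"
    using u uv \<open>0 < v\<close> by (simp add: \<Gamma>_def field_simps)
  have "measure_pmf.expectation p (\<lambda>x. if Y x > K then 1 else if Y x < K then 0 else \<Gamma>)
      = measure_pmf.expectation p
          (\<lambda>x. indicator {x. K < Y x} x + \<Gamma> * indicator {x. Y x = K} x)"
    by (intro Bochner_Integration.integral_cong) (auto simp: indicator_def)
  also have "\<dots> = u + \<Gamma> * v"
    unfolding u_def v_def by (simp add: integrable_measure_pmf_finite fin)
  also have "\<dots> = \<alpha>" using \<open>0 < v\<close> by (simp add: \<Gamma>_def)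
  finally show ?thesis using \<Gamma> by blast
qed

section \<open>Symmetries of Condorcet's model\<close>

lemma binrelsI:
  assumes "V \<subseteq> A \<times> A" "\<And>x. (x, x) \<notin> V"
    and "\<And>x y. x \<in> A \<Longrightarrow> y \<in> A \<Longrightarrow> x \<noteq> y \<Longrightarrow> (y, x) \<in> V \<longleftrightarrow> (x, y) \<notin> V"
  shows "V \<in> binrels A"
  using assms unfolding binrels_def irrefl_def antisym_def total_on_def by blast

lemma binrels_subset: "V \<in> binrels A \<Longrightarrow> V \<subseteq> A \<times> A"
  by (simp add: binrels_def)

lemma binrels_irrefl: "V \<in> binrels A \<Longrightarrow> (x, x) \<notin> V"
  by (simp add: binrels_def irrefl_def)

lemma binrels_swap:
  assumes "V \<in> binrels A" "x \<in> A" "y \<in> A" "x \<noteq> y"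
  shows "(y, x) \<in> V \<longleftrightarrow> (x, y) \<notin> V"
  using assms unfolding binrels_def antisym_def total_on_def by blast

text \<open>Reversing every comparison on which \<open>W\<close> and \<open>W'\<close> disagree is an involution of the vote space
  that sends \<open>W\<close> to \<open>W'\<close>.\<close>

definition reverse_diff :: "'a rel \<Rightarrow> 'a rel \<Rightarrow> 'a rel \<Rightarrow> 'a rel" where
  "reverse_diff W W' V = sym_diff V (sym_diff W W')"

lemma in_reverse_diff:
  "p \<in> reverse_diff W W' V \<longleftrightarrow> (p \<in> V \<longleftrightarrow> (p \<in> W \<longleftrightarrow> p \<in> W'))"
  by (auto simp: reverse_diff_def)

lemma reverse_diff_involution [simp]: "reverse_diff W W' (reverse_diff W W' V) = V"
  by (intro set_eqI) (simp only: in_reverse_diff, argo)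

lemma reverse_diff_in_binrels:
  assumes W: "W \<in> binrels A" "W' \<in> binrels A"
  shows "reverse_diff W W' V \<in> binrels A \<longleftrightarrow> V \<in> binrels A"
proof -
  have "reverse_diff W W' V \<in> binrels A" if V: "V \<in> binrels A" for V
  proof (rule binrelsI)
    show "reverse_diff W W' V \<subseteq> A \<times> A"
      using W[THEN binrels_subset] binrels_subset[OF V] unfolding reverse_diff_def by blast
    show "(x, x) \<notin> reverse_diff W W' V" for x
      using W[THEN binrels_irrefl] binrels_irrefl[OF V] by (simp add: in_reverse_diff)
    show "(y, x) \<in> reverse_diff W W' V \<longleftrightarrow> (x, y) \<notin> reverse_diff W W' V"
      if "x \<in> A" "y \<in> A" "x \<noteq> y" for x y
      unfolding in_reverse_diff
      using binrels_swap[OF V that] binrels_swap[OF W(1) that] binrels_swap[OF W(2) that] by argo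
  qed
  from this[of V] this[of "reverse_diff W W' V"] show ?thesis by auto
qed

lemma KT_reverse_diff: "KT A (reverse_diff W W' V) W' = KT A V W"
proof -
  have "((b, c) \<in> reverse_diff W W' V) \<noteq> ((b, c) \<in> W') \<longleftrightarrow> ((b, c) \<in> V) \<noteq> ((b, c) \<in> W)" for b c
    unfolding in_reverse_diff by argo
  then show ?thesis by (simp only: KT_def)
qed

lemma condorcet_Z_const:
  assumes "W \<in> binrels A" "W' \<in> binrels A"
  shows "condorcet_Z A \<phi> W = condorcet_Z A \<phi> W'"
  unfolding condorcet_Z_def
  by (rule sum.reindex_bij_witness[of _ "reverse_diff W W'" "reverse_diff W W'"])
     (simp_all add: reverse_diff_in_binrels[OF assms] KT_reverse_diff)

lemma condorcet_pmf_reverse_diff: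
  assumes "finite A" "0 < \<phi>" "W \<in> binrels A" "W' \<in> binrels A"
  shows "condorcet_pmf A \<phi> W' = map_pmf (reverse_diff W W') (condorcet_pmf A \<phi> W)"
proof (rule pmf_eqI)
  fix V
  let ?T = "reverse_diff W W'"
  have "inj ?T" by (rule inj_on_inverseI[where g = ?T]) simp
  from pmf_map_inj'[OF this, of "condorcet_pmf A \<phi> W" "?T V"]
  have "pmf (map_pmf ?T (condorcet_pmf A \<phi> W)) V = pmf (condorcet_pmf A \<phi> W) (?T V)"
    by simp
  also have "\<dots> = pmf (condorcet_pmf A \<phi> W') V"
    using assms KT_reverse_diff[of A W W' "?T V"]
    by (simp add: pmf_condorcet_pmf reverse_diff_in_binrels[OF assms(3,4)] condorcet_Z_const[OF assms(3,4)])
  finally show "pmf (condorcet_pmf A \<phi> W') V = pmf (map_pmf ?T (condorcet_pmf A \<phi> W)) V"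
    by simp
qed

lemma replicate_pmf_map:
  "replicate_pmf n (map_pmf T p) = map_pmf (map T) (replicate_pmf n p)"
  by (induction n) (simp_all add: map_bind_pmf bind_map_pmf)

lemma replicate_pmf_Suc_pair:
  "replicate_pmf (Suc n) p = map_pmf (\<lambda>(x, xs). x # xs) (pair_pmf p (replicate_pmf n p))"
  by (simp add: pair_pmf_def map_bind_pmf)

lemma pmf_replicate_pmf_Cons:
  "pmf (replicate_pmf (Suc n) p) (x # xs) = pmf p x * pmf (replicate_pmf n p) xs"
proof -
  have "inj (\<lambda>(x, xs). x # xs)" by (auto simp: inj_def)
  from pmf_map_inj'[OF this, of "pair_pmf p (replicate_pmf n p)" "(x, xs)"]
  show ?thesis by (simp add: pmf_pair del: replicate_pmf.simps add: replicate_pmf_Suc_pair)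
qed

section \<open>Margins against a fixed alternative\<close>

lemma set_margin_Nil [simp]: "set_margin [] B a = 0"
  by (simp add: set_margin_def margin_def votes_def)

lemma set_margin_Cons: "set_margin (V # P) B a = set_margin [V] B a + set_margin P B a"
  unfolding set_margin_def margin_def votes_def by (simp flip: sum.distrib) (rule sum.cong, auto)

lemma set_margin_replicate: "set_margin (replicate k V) B a = int k * set_margin [V] B a"
proof (induction k)
  case (Suc k)
  then show ?case
    using set_margin_Cons[of V "replicate k V" B a] by (simp add: algebra_simps)
qed simp

lemma set_margin_single:
  assumes "finite B"
  shows "set_margin [V] B a = int (card {b\<in>B. (b, a) \<in> V}) - int (card {b\<in>B. (a, b) \<in> V})"
  using assms
  by (simp add: set_margin_def margin_def votes_def sum_subtractf sum.If_cases Int_def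
      if_distrib[of length] if_distrib[of int])

lemma set_margin_single_above:
  assumes "finite A" "V \<in> rels_above A C a" "a \<in> A" "B \<subseteq> A - {a}"
  shows "set_margin [V] B a = 2 * int (card (B \<inter> C)) - int (card B)"
proof -
  have fin: "finite B" using assms by (auto intro: finite_subset)
  have V: "V \<in> binrels A" and C: "\<And>b. b \<in> A \<Longrightarrow> (b, a) \<in> V \<longleftrightarrow> b \<in> C"
    using assms(2) by (auto simp: rels_above_def)
  have up: "{b\<in>B. (b, a) \<in> V} = B \<inter> C"
    using C assms(4) by auto
  have down: "{b\<in>B. (a, b) \<in> V} = B - C"
  proof -
    have "(a, b) \<in> V \<longleftrightarrow> b \<notin> C" if "b \<in> B" for b
    proof -
      have b: "b \<in> A" "b \<noteq> a" using that assms(4) by auto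
      show ?thesis
        using binrels_swap[OF V b(1) assms(3) b(2)] C[OF b(1)] by simp
    qed
    then show ?thesis by blast
  qed
  have "int (card B) = int (card (B \<inter> C)) + int (card (B - C))"
    using card_Int_Diff[OF fin] by (metis of_nat_add)
  then show ?thesis
    unfolding set_margin_single[OF fin] up down by linarith
qed

text \<open>Two hypotheses in \<^term>\<open>rels_top A a\<close> disagree only on pairs that avoid \<open>a\<close>, and reversing those
  pairs leaves every margin against \<open>a\<close> unchanged.\<close>

lemma expectation_margin_const:
  fixes F :: "int \<Rightarrow> real"
  assumes "finite A" "0 < \<phi>" "W \<in> rels_top A a" "W' \<in> rels_top A a" "B \<subseteq> A - {a}" "a \<in> A"
  shows "measure_pmf.expectation (condorcet_model A \<phi> n W') (\<lambda>P. F (set_margin P B a))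
       = measure_pmf.expectation (condorcet_model A \<phi> n W) (\<lambda>P. F (set_margin P B a))"
proof -
  let ?T = "reverse_diff W W'"
  have W: "W \<in> binrels A" "W' \<in> binrels A"
    using assms by (auto simp: rels_top_def)
  have ab: "(a, b) \<in> ?T V \<longleftrightarrow> (a, b) \<in> V" and ba: "(b, a) \<in> ?T V \<longleftrightarrow> (b, a) \<in> V" if "b \<in> B" for b V
  proof -
    have b: "b \<in> A" "b \<noteq> a" using that assms by auto
    have in_W: "(a, b) \<in> W" "(a, b) \<in> W'" using b assms by (auto simp: rels_top_def)
    then have "(b, a) \<notin> W" "(b, a) \<notin> W'"
      using binrels_swap[OF W(1) assms(6) b(1)] binrels_swap[OF W(2) assms(6) b(1)] b(2) by auto
    with in_W show "(a, b) \<in> ?T V \<longleftrightarrow> (a, b) \<in> V" "(b, a) \<in> ?T V \<longleftrightarrow> (b, a) \<in> V"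
      by (simp_all add: in_reverse_diff)
  qed
  have "set_margin (map ?T P) B a = set_margin P B a" for P
    unfolding set_margin_def margin_def votes_def
    by (rule sum.cong) (auto simp: filter_map o_def ab ba)
  then show ?thesis
    using assms W
    by (simp add: condorcet_model_def condorcet_pmf_reverse_diff[of A \<phi> W W'] replicate_pmf_map)
qed

text \<open>With \<open>C = {}\<close> this raises \<open>a\<close> to the top, pairing each hypothesis of \<open>H1\<close> with the null hypothesis
  that differs from it only in comparisons with \<open>a\<close>.\<close>

definition place_below :: "'a set \<Rightarrow> 'a set \<Rightarrow> 'a \<Rightarrow> 'a rel \<Rightarrow> 'a rel" where
  "place_below A C a V =
     {(x, y) \<in> V. x \<noteq> a \<and> y \<noteq> a} \<union> C \<times> {a} \<union> {a} \<times> (A - {a} - C)"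

lemma place_below_in_binrels:
  assumes V: "V \<in> binrels A" and a: "a \<in> A" and C: "C \<subseteq> A - {a}"
  shows "place_below A C a V \<in> binrels A"
proof (rule binrelsI)
  show "place_below A C a V \<subseteq> A \<times> A"
    using binrels_subset[OF V] a C by (auto simp: place_below_def)
  show "(x, x) \<notin> place_below A C a V" for x
    using binrels_irrefl[OF V] C by (auto simp: place_below_def)
  show "(y, x) \<in> place_below A C a V \<longleftrightarrow> (x, y) \<notin> place_below A C a V"
    if "x \<in> A" "y \<in> A" "x \<noteq> y" for x y
    using binrels_swap[OF V that] that C unfolding place_below_def by auto
qed

lemma place_below_rels_above:
  assumes "V \<in> binrels A" "a \<in> A" "C \<subseteq> A - {a}"
  shows "place_below A C a V \<in> rels_above A C a"
  using place_below_in_binrels[OF assms] assms(3)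
  by (auto simp: rels_above_def place_below_def)

lemma place_below_empty_rels_top:
  assumes "V \<in> binrels A" "a \<in> A"
  shows "place_below A {} a V \<in> rels_top A a"
  using place_below_in_binrels[OF assms, of "{}"] by (auto simp: rels_top_def place_below_def)

lemma exists_rels_above:
  assumes "finite A" "a \<in> A" "C \<subseteq> A - {a}"
  shows "\<exists>V. V \<in> rels_above A C a"
  using binrels_nonempty[OF assms(1)] place_below_rels_above[OF _ assms(2,3)] by blast

lemma exists_rels_top:
  assumes "finite A" "a \<in> A"
  shows "\<exists>V. V \<in> rels_top A a"
  using binrels_nonempty[OF assms(1)] place_below_empty_rels_top[OF _ assms(2)] by blast

section \<open>The likelihood ratio\<close>

text \<open>Each unordered pair of disagreement is represented by the one of its two orientations that
  \<open>V\<close> contains.\<close>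

lemma KT_eq_card_Diff:
  assumes "V \<in> binrels A" "W \<in> binrels A"
  shows "KT A V W = card (V - W)"
proof -
  have "bij_betw (\<lambda>(b, c). {b, c}) (V - W)
    {{b, c} | b c. b \<in> A \<and> c \<in> A \<and> b \<noteq> c \<and> ((b, c) \<in> V) \<noteq> ((b, c) \<in> W)}"
  proof (rule bij_betw_imageI)
    show "inj_on (\<lambda>(b, c). {b, c}) (V - W)"
    proof (rule inj_onI, clarify)
      fix b c b' c'
      assume "(b, c) \<in> V" "(b', c') \<in> V" "{b, c} = {b', c'}"
      then show "b = b' \<and> c = c'"
        using binrels_swap[OF assms(1)] binrels_subset[OF assms(1)] binrels_irrefl[OF assms(1)]
        unfolding doubleton_eq_iff by blast
    qed
    show "(\<lambda>(b, c). {b, c}) ` (V - W) =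
      {{b, c} | b c. b \<in> A \<and> c \<in> A \<and> b \<noteq> c \<and> ((b, c) \<in> V) \<noteq> ((b, c) \<in> W)}" (is "?L = ?R")
    proof
      show "?L \<subseteq> ?R"
        using binrels_subset[OF assms(1)] binrels_irrefl[OF assms(1)] by fastforce
      show "?R \<subseteq> ?L"
      proof clarify
        fix b c assume bc: "b \<in> A" "c \<in> A" "b \<noteq> c" "((b, c) \<in> V) \<noteq> ((b, c) \<in> W)"
        then have "(b, c) \<in> V - W \<or> (c, b) \<in> V - W"
          using binrels_swap[OF assms(1) bc(1-3)] binrels_swap[OF assms(2) bc(1-3)] by blast
        then show "{b, c} \<in> ?L"
        proof
          assume "(c, b) \<in> V - W"
          then show ?thesis by (intro image_eqI[of _ _ "(c, b)"]) auto
        qed (intro image_eqI[of _ _ "(b, c)"], auto)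
      qed
    qed
  qed
  then show ?thesis unfolding KT_def by (simp add: bij_betw_same_card)
qed

text \<open>Raising \<open>a\<close> to the top reverses exactly the pairs \<open>(b, a)\<close> with \<open>b \<in> B\<close>, so the two distances
  differ by the number of those pairs on which \<open>V\<close> sides with \<open>b\<close>, minus the number on which it
  sides with \<open>a\<close>.\<close>

lemma KT_raise_top:
  assumes "finite A" "V \<in> binrels A" "W \<in> rels_above A B a" "a \<in> A"
  shows "int (KT A V (place_below A {} a W)) = int (KT A V W) + set_margin [V] B a"
proof -
  let ?W0 = "place_below A {} a W"
  let ?up = "{b\<in>B. (b, a) \<in> V}" and ?down = "{b\<in>B. (a, b) \<in> V}"
  have W: "W \<in> binrels A" and B: "B = {b \<in> A. (b, a) \<in> W}"
    using assms by (auto simp: rels_above_def)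
  have W0: "?W0 \<in> binrels A"
    using place_below_empty_rels_top[OF W assms(4)] by (simp add: rels_top_def)
  have "finite B" using B assms(1) by simp
  have "finite V"
    using assms(1) binrels_subset[OF assms(2)] by (auto intro: finite_subset)
  have W0_eq: "?W0 = {(x, y) \<in> W. x \<noteq> a \<and> y \<noteq> a} \<union> {a} \<times> (A - {a})"
    by (simp add: place_below_def)
  \<comment> \<open>Disagreements of \<open>V\<close> with both relations; a disagreement with only one of them is a pair of
    \<open>a\<close> and an element of \<open>B\<close>.\<close>
  define C where "C = V - W - ?W0"
  have V_sub: "\<And>x y. (x, y) \<in> V \<Longrightarrow> x \<in> A \<and> y \<in> A" and V_irr: "\<And>x. (x, x) \<notin> V"
    using binrels_subset[OF assms(2)] binrels_irrefl[OF assms(2)] by auto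
  have W_a: "(b, a) \<in> W \<longleftrightarrow> b \<in> B" "(a, b) \<in> W \<longleftrightarrow> b \<in> A \<and> b \<noteq> a \<and> b \<notin> B" "b \<in> B \<Longrightarrow> b \<in> A" for b
    using binrels_subset[OF W] binrels_irrefl[OF W] binrels_swap[OF W _ assms(4), of b]
    unfolding B by auto
  have 1: "V - W = C \<union> (\<lambda>b. (a, b)) ` ?down" "C \<inter> (\<lambda>b. (a, b)) ` ?down = {}"
    using V_sub V_irr W_a unfolding C_def W0_eq by auto
  have 2: "V - ?W0 = C \<union> (\<lambda>b. (b, a)) ` ?up" "C \<inter> (\<lambda>b. (b, a)) ` ?up = {}"
    using V_sub V_irr W_a unfolding C_def W0_eq by auto
  have fin: "finite C" "finite ?up" "finite ?down"
    using \<open>finite V\<close> \<open>finite B\<close> by (auto simp: C_def)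
  have "KT A V W = card C + card ?down"
    unfolding KT_eq_card_Diff[OF assms(2) W] 1(1)
    by (subst card_Un_disjoint) (use fin 1(2) in \<open>auto simp: card_image inj_on_def\<close>)
  moreover have "KT A V ?W0 = card C + card ?up"
    unfolding KT_eq_card_Diff[OF assms(2) W0] 2(1)
    by (subst card_Un_disjoint) (use fin 2(2) in \<open>auto simp: card_image inj_on_def\<close>)
  ultimately show ?thesis
    by (simp add: set_margin_single[OF \<open>finite B\<close>])
qed

lemma likelihood_ratio_single:
  assumes "finite A" "0 < \<phi>" "V \<in> binrels A" "W \<in> rels_above A B a" "a \<in> A"
  shows "pmf (condorcet_pmf A \<phi> W) V =
    \<phi> powr (- real_of_int (set_margin [V] B a)) * pmf (condorcet_pmf A \<phi> (place_below A {} a W)) V"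
proof -
  let ?W0 = "place_below A {} a W"
  have W: "W \<in> binrels A" using assms by (simp add: rels_above_def)
  have W0: "?W0 \<in> binrels A"
    using place_below_empty_rels_top[OF W assms(5)] by (simp add: rels_top_def)
  have "real_of_int (int (KT A V ?W0)) = real_of_int (int (KT A V W) + set_margin [V] B a)"
    using KT_raise_top[OF assms(1,3,4,5)] by simp
  then have "real (KT A V W) = - real_of_int (set_margin [V] B a) + real (KT A V ?W0)"
    by simp
  then have "\<phi> ^ KT A V W = \<phi> powr (- real_of_int (set_margin [V] B a)) * \<phi> ^ KT A V ?W0"
    using \<open>0 < \<phi>\<close> by (simp flip: powr_realpow powr_add)
  then show ?thesis
    using assms condorcet_Z_const[OF W W0, of \<phi>] by (simp add: pmf_condorcet_pmf)
qed

lemma likelihood_ratio: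
  assumes "finite A" "0 < \<phi>" "W \<in> rels_above A B a" "a \<in> A" "P \<in> profiles A n"
  shows "pmf (condorcet_model A \<phi> n W) P =
    \<phi> powr (- real_of_int (set_margin P B a)) *
    pmf (condorcet_model A \<phi> n (place_below A {} a W)) P"
  using assms(5)
proof (induction P arbitrary: n)
  case Nil
  then show ?case using \<open>0 < \<phi>\<close> by (simp add: profiles_def condorcet_model_def)
next
  case (Cons V P)
  then obtain k where n: "n = Suc k" by (cases n) (auto simp: profiles_def)
  have V: "V \<in> binrels A" and P: "P \<in> profiles A k"
    using Cons.prems n by (auto simp: profiles_def)
  show ?case
    using likelihood_ratio_single[OF assms(1,2) V assms(3,4)] Cons.IH[OF P]
    unfolding n condorcet_model_def pmf_replicate_pmf_Cons set_margin_Cons[of V P]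
    by (simp add: powr_diff powr_minus field_simps)
qed

section \<open>Optimality and essential uniqueness of the margin test\<close>

lemma finite_profiles: "finite A \<Longrightarrow> finite (profiles A n)"
  unfolding profiles_def by (intro finite_lists_length_eq finite_binrels)

lemma finite_rels_top: "finite A \<Longrightarrow> finite (rels_top A a)"
  using finite_binrels[of A] by (simp add: rels_top_def)

lemma is_test_margin_test: "\<Gamma> \<in> {0..1} \<Longrightarrow> is_test X (margin_test K \<Gamma> a B)"
  by (auto simp: is_test_def margin_test_def)

lemma test_size_at_le:
  assumes "finite H0" "h \<in> H0"
  shows "test_size_at \<pi> f h \<le> test_size \<pi> H0 f"
  unfolding test_size_def using assms by (intro cSUP_upper) auto

lemma test_size_margin_test:
  assumes "finite A" "0 < \<phi>" "a \<in> A" "B \<subseteq> A - {a}" "h \<in> rels_top A a"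
  shows "test_size (condorcet_model A \<phi> n) (rels_top A a) (margin_test K \<Gamma> a B)
       = measure_pmf.expectation (condorcet_model A \<phi> n h) (margin_test K \<Gamma> a B)"
proof -
  define F where "F k = (if real_of_int k > K then 1 else if real_of_int k < K then 0 else \<Gamma>)" for k
  have F: "margin_test K \<Gamma> a B = (\<lambda>P. F (set_margin P B a))"
    by (auto simp: margin_test_def F_def)
  have "test_size_at (condorcet_model A \<phi> n) (margin_test K \<Gamma> a B) h'
      = measure_pmf.expectation (condorcet_model A \<phi> n h) (margin_test K \<Gamma> a B)"
    if "h' \<in> rels_top A a" for h'
    unfolding test_size_at_def F
    by (rule expectation_margin_const) (use assms that in auto)
  then have "test_size (condorcet_model A \<phi> n) (rels_top A a) (margin_test K \<Gamma> a B)
    = (SUP h'\<in>rels_top A a.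
         measure_pmf.expectation (condorcet_model A \<phi> n h) (margin_test K \<Gamma> a B))"
    unfolding test_size_def by (intro SUP_cong) auto
  also have "\<dots> = measure_pmf.expectation (condorcet_model A \<phi> n h) (margin_test K \<Gamma> a B)"
    using assms(5) by (intro cSUP_const) auto
  finally show ?thesis .
qed

lemma exists_margin_test_of_size:
  assumes "finite A" "0 < \<phi>" "a \<in> A" "B \<subseteq> A - {a}" "0 < \<alpha>" "\<alpha> < 1"
  shows "\<exists>K \<Gamma>. \<Gamma> \<in> {0..1} \<and>
    test_size (condorcet_model A \<phi> n) (rels_top A a) (margin_test K \<Gamma> a B) = \<alpha>"
proof -
  obtain h where h: "h \<in> rels_top A a" using exists_rels_top[OF assms(1,3)] by blast
  have "finite (set_pmf (condorcet_model A \<phi> n h))"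
    using assms by (simp add: set_pmf_condorcet_model finite_profiles)
  from exists_randomized_threshold[OF this \<open>0 < \<alpha>\<close> less_imp_le[OF \<open>\<alpha> < 1\<close>],
      where Y = "\<lambda>P. real_of_int (set_margin P B a)"]
  show ?thesis
    unfolding test_size_margin_test[OF assms(1-4) h] unfolding margin_test_def[abs_def] .
qed

text \<open>The hypothesis \<open>h\<close> is compared with the null hypothesis obtained from it by raising \<open>a\<close> to the
  top. Their likelihood ratio is \<open>\<phi> powr (- w)\<close> for the margin \<open>w\<close>, increasing in \<open>w\<close> since
  \<open>\<phi> < 1\<close>, so rejecting for large margins is the likelihood ratio test with constant
  \<open>\<phi> powr (- K)\<close>, and ties occur exactly at \<open>w = K\<close>.\<close>

lemma margin_test_neyman_pearson:
  assumes "finite A" "0 < \<phi>" "\<phi> < 1" "a \<in> A" "B \<subseteq> A - {a}" "h \<in> rels_above A B a"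
    and f: "is_test (profiles A n) f"
    and size: "test_size (condorcet_model A \<phi> n) (rels_top A a) f
      \<le> test_size (condorcet_model A \<phi> n) (rels_top A a) (margin_test K \<Gamma> a B)"
  shows "test_power (condorcet_model A \<phi> n) f h
      \<le> test_power (condorcet_model A \<phi> n) (margin_test K \<Gamma> a B) h" (is ?optimal)
    and "test_power (condorcet_model A \<phi> n) (margin_test K \<Gamma> a B) h
      \<le> test_power (condorcet_model A \<phi> n) f h \<Longrightarrow> P \<in> profiles A n \<Longrightarrow>
      real_of_int (set_margin P B a) \<noteq> K \<Longrightarrow> f P = margin_test K \<Gamma> a B P"
proof -
  let ?h0 = "place_below A {} a h"
  let ?p0 = "condorcet_model A \<phi> n ?h0" and ?p1 = "condorcet_model A \<phi> n h"
  let ?c = "\<phi> powr (- K)"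
  have h0: "?h0 \<in> rels_top A a"
    using place_below_empty_rels_top assms(4,6) by (auto simp: rels_above_def)
  have supp: "set_pmf ?p0 \<subseteq> profiles A n" "set_pmf ?p1 \<subseteq> profiles A n"
    using assms by (simp_all add: set_pmf_condorcet_model)
  have powr_less: "\<phi> powr (- x) < \<phi> powr (- y) \<longleftrightarrow> x < y" for x y
  proof -
    have "ln \<phi> < 0" using assms(2,3) by simp
    then show ?thesis using assms(2) by (simp add: powr_def)
  qed
  have pos: "0 < pmf ?p0 P" if "P \<in> profiles A n" for P
    using that assms by (simp add: pmf_positive set_pmf_condorcet_model)
  have greater: "pmf ?p1 P > ?c * pmf ?p0 P \<longleftrightarrow> real_of_int (set_margin P B a) > K"
    and less: "pmf ?p1 P < ?c * pmf ?p0 P \<longleftrightarrow> real_of_int (set_margin P B a) < K"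
    if "P \<in> profiles A n" for P
    unfolding likelihood_ratio[OF assms(1,2,6,4) that]
      mult_less_cancel_right_pos[OF pos[OF that]] powr_less by (rule refl)+
  have "test_size_at (condorcet_model A \<phi> n) f ?h0
      \<le> test_size (condorcet_model A \<phi> n) (rels_top A a) f"
    using assms(1) h0 by (intro test_size_at_le finite_rels_top)
  with size have size0: "measure_pmf.expectation ?p0 f
      \<le> measure_pmf.expectation ?p0 (margin_test K \<Gamma> a B)"
    unfolding test_size_margin_test[OF assms(1,2,4,5) h0] test_size_at_def by linarith
  note NP = neyman_pearson[OF finite_profiles[OF assms(1)] supp powr_ge_zero f _ _ size0]
  have reject: "margin_test K \<Gamma> a B P = 1"
    if "P \<in> profiles A n" "pmf ?p1 P > ?c * pmf ?p0 P" for P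
    using that greater by (simp add: margin_test_def)
  have accept: "margin_test K \<Gamma> a B P = 0"
    if "P \<in> profiles A n" "pmf ?p1 P < ?c * pmf ?p0 P" for P
    using that less by (simp add: margin_test_def)
  show ?optimal
    unfolding test_power_def by (rule NP(1)[OF reject accept])
  show "f P = margin_test K \<Gamma> a B P"
    if "test_power (condorcet_model A \<phi> n) (margin_test K \<Gamma> a B) h
      \<le> test_power (condorcet_model A \<phi> n) f h"
      and P: "P \<in> profiles A n" and off: "real_of_int (set_margin P B a) \<noteq> K"
  proof (rule NP(2)[OF reject accept that(1)[unfolded test_power_def] P])
    show "pmf ?p1 P \<noteq> ?c * pmf ?p0 P"
      using greater[OF P] less[OF P] off by linarith
  qed
qed

lemma margin_test_ump:
  assumes "finite A" "0 < \<phi>" "\<phi> < 1" "a \<in> A" "B \<subseteq> A - {a}" "H1 \<subseteq> rels_above A B a"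
    and "\<Gamma> \<in> {0..1}"
    and "test_size (condorcet_model A \<phi> n) (rels_top A a) (margin_test K \<Gamma> a B) = \<alpha>"
  shows "ump_test (profiles A n) (condorcet_model A \<phi> n) (rels_top A a) H1 \<alpha> (margin_test K \<Gamma> a B)"
  unfolding ump_test_def
proof (intro conjI ballI allI impI)
  show "is_test (profiles A n) (margin_test K \<Gamma> a B)"
    by (rule is_test_margin_test[OF assms(7)])
  fix h g
  assume "h \<in> H1" and g: "is_test (profiles A n) g \<and>
    test_size (condorcet_model A \<phi> n) (rels_top A a) g \<le> \<alpha>"
  then have "h \<in> rels_above A B a" using assms(6) by blast
  then show "test_power (condorcet_model A \<phi> n) g h
      \<le> test_power (condorcet_model A \<phi> n) (margin_test K \<Gamma> a B) h"
    using g assms(8) by (intro margin_test_neyman_pearson(1)[OF assms(1-5)]) simp_all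
qed (rule assms(8))

text \<open>A uniformly most powerful \<open>f\<close> has at \<open>h\<close> at least the power of the margin test, so it falls
  under the equality case of the Neyman-Pearson lemma. Elements of \<open>H1\<close> with different upper sets
  thus impose separate, almost complete prescriptions on the same \<open>f\<close>.\<close>

lemma ump_test_eq_margin_test:
  assumes "finite A" "0 < \<phi>" "\<phi> < 1" "a \<in> A" "B \<subseteq> A - {a}" "h \<in> rels_above A B a" "h \<in> H1"
    and ump: "ump_test (profiles A n) (condorcet_model A \<phi> n) (rels_top A a) H1 \<alpha> f"
    and "\<Gamma> \<in> {0..1}"
    and size: "test_size (condorcet_model A \<phi> n) (rels_top A a) (margin_test K \<Gamma> a B) = \<alpha>"
    and "P \<in> profiles A n" "real_of_int (set_margin P B a) \<noteq> K"
  shows "f P = margin_test K \<Gamma> a B P"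
proof (rule margin_test_neyman_pearson(2)[OF assms(1-6)])
  show "test_power (condorcet_model A \<phi> n) (margin_test K \<Gamma> a B) h
      \<le> test_power (condorcet_model A \<phi> n) f h"
  proof -
    have "\<forall>h1\<in>H1. \<forall>g. is_test (profiles A n) g \<and>
        test_size (condorcet_model A \<phi> n) (rels_top A a) g \<le> \<alpha> \<longrightarrow>
        test_power (condorcet_model A \<phi> n) f h1 \<ge> test_power (condorcet_model A \<phi> n) g h1"
      using ump unfolding ump_test_def by blast
    from bspec[OF this \<open>h \<in> H1\<close>, rule_format, of "margin_test K \<Gamma> a B"]
    show ?thesis
      using is_test_margin_test[OF \<open>\<Gamma> \<in> {0..1}\<close>, of "profiles A n" K a B] size by simp
  qed
qed (use ump size assms(11,12) in \<open>auto simp: ump_test_def\<close>)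

section \<open>Alternatives with different upper sets\<close>

text \<open>At the level at which the margin test for \<open>B1\<close> rejects exactly when all votes place all of \<open>B1\<close>
  above \<open>a\<close>, a uniformly most powerful test would have to be that test. It rejects a profile \<open>P\<close> in
  which everything outside \<open>B1\<close> is below \<open>a\<close>, and accepts a profile \<open>Q\<close> in which everything is above
  \<open>a\<close> except a single \<open>y \<in> B1\<close> in a single vote. Going from \<open>P\<close> to \<open>Q\<close> changes the margin of \<open>B2\<close>
  by at least \<open>+ 2 n\<close> through an element of \<open>B2 - B1\<close> and by no worse than \<open>- 2\<close> through \<open>y\<close>, so for
  \<open>n \<ge> 2\<close> the margin of \<open>B2\<close> is larger on \<open>Q\<close>, against optimality for \<open>B2\<close>.\<close>

lemma no_ump_of_distinct_upper_sets:
  assumes A: "finite A" and \<phi>: "0 < \<phi>" "\<phi> < 1" and a: "a \<in> A" and n: "n \<ge> 2"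
    and B1: "B1 \<subseteq> A - {a}" "B1 \<noteq> {}" and B2: "B2 \<subseteq> A - {a}" "\<not> B2 \<subseteq> B1"
    and h1: "h1 \<in> rels_above A B1 a" "h1 \<in> H1" and h2: "h2 \<in> rels_above A B2 a" "h2 \<in> H1"
  shows "\<exists>\<alpha>. 0 < \<alpha> \<and> \<alpha> < 1 \<and>
    \<not> (\<exists>f. ump_test (profiles A n) (condorcet_model A \<phi> n) (rels_top A a) H1 \<alpha> f)"
proof -
  obtain y where y: "y \<in> B1" using B1 by blast
  obtain x where x: "x \<in> B2" "x \<notin> B1" using B2 by blast
  have finB: "finite B1" "finite B2" using A B1 B2 by (auto intro: finite_subset)
  obtain U where U: "U \<in> rels_above A (A - {a}) a"
    using exists_rels_above[OF A a] by blast
  obtain V where V: "V \<in> rels_above A (A - {a} - {y}) a"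
    using exists_rels_above[OF A a, of "A - {a} - {y}"] by blast
  define P where "P = replicate n h1"
  define Q where "Q = V # replicate (n - 1) U"
  have P: "P \<in> profiles A n" and Q: "Q \<in> profiles A n"
    using h1 U V n by (auto simp: P_def Q_def profiles_def rels_above_def)
  have margin_P: "set_margin P B a = int n * (2 * int (card (B \<inter> B1)) - int (card B))"
    if "B \<subseteq> A - {a}" for B
    unfolding P_def set_margin_replicate set_margin_single_above[OF A h1(1) a that] ..
  have margin_Q: "set_margin Q B a
      = 2 * int (card (B - {y})) - int (card B) + (int n - 1) * int (card B)"
    if B: "B \<subseteq> A - {a}" for B
  proof -
    have *: "B \<inter> (A - {a}) = B" "B \<inter> (A - {a} - {y}) = B - {y}"
      using B by auto
    show ?thesis
      unfolding Q_def set_margin_Cons[of V "replicate (n - 1) U"] set_margin_replicate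
        set_margin_single_above[OF A U a B] set_margin_single_above[OF A V a B] *
      using n by (simp add: of_nat_diff)
  qed
  \<comment> \<open>The maximal margin of \<open>B1\<close> is \<open>n * card B1\<close> and margins are integers, so this threshold
    isolates the maximum.\<close>
  define K1 :: real where "K1 = real n * real (card B1) - 1"
  have "real_of_int (set_margin P B1 a) = K1 + 1"
    unfolding margin_P[OF B1(1)] K1_def by (simp add: algebra_simps)
  then have P1: "real_of_int (set_margin P B1 a) > K1" by simp
  have "1 \<le> card B1" using finB y by (metis One_nat_def Suc_leI card_gt_0_iff empty_iff)
  then have "int (card (B1 - {y})) = int (card B1) - 1"
    using y finB by (simp add: card_Diff_singleton of_nat_diff)
  then have "set_margin Q B1 a = int n * int (card B1) - 2"
    unfolding margin_Q[OF B1(1)] by (simp add: algebra_simps)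
  then have "real_of_int (set_margin Q B1 a) = K1 - 1"
    by (simp add: K1_def)
  then have Q1: "real_of_int (set_margin Q B1 a) < K1" by simp
  have margin_less: "set_margin P B2 a < set_margin Q B2 a"
  proof -
    have "B2 \<inter> B1 \<subseteq> B2 - {x}" using x by auto
    then have "card (B2 \<inter> B1) \<le> card (B2 - {x})" using finB by (intro card_mono) auto
    moreover have "card (B2 - {x}) < card B2" using x finB by (intro card_Diff1_less) auto
    ultimately have "2 * int (card (B2 \<inter> B1)) - int (card B2) \<le> int (card B2) - 2" by linarith
    then have "set_margin P B2 a \<le> int n * (int (card B2) - 2)"
      unfolding margin_P[OF B2(1)] by (intro mult_left_mono) auto
    also have "\<dots> < int n * int (card B2) - 2"
      using n by (simp add: algebra_simps)
    also have "int n * int (card B2) - 2 \<le> set_margin Q B2 a"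
    proof -
      have "card B2 - 1 \<le> card (B2 - {y})"
        by (simp add: card_Diff_singleton_if)
      then have "2 * int (card B2) - 2 \<le> 2 * int (card (B2 - {y}))" by linarith
      then show ?thesis
        unfolding margin_Q[OF B2(1)] by (simp add: algebra_simps)
    qed
    finally show ?thesis .
  qed
  obtain h where h: "h \<in> rels_top A a" using exists_rels_top[OF A a] by blast
  define p where "p = condorcet_model A \<phi> n h"
  define \<alpha> where "\<alpha> = test_size (condorcet_model A \<phi> n) (rels_top A a) (margin_test K1 0 a B1)"
  have "\<alpha> = measure_pmf.expectation p (indicator {R. K1 < real_of_int (set_margin R B1 a)})"
    unfolding \<alpha>_def test_size_margin_test[OF A \<phi>(1) a B1(1) h] p_def
    by (intro Bochner_Integration.integral_cong) (auto simp: margin_test_def indicator_def)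
  then have \<alpha>: "\<alpha> = measure_pmf.prob p {R. K1 < real_of_int (set_margin R B1 a)}"
    by simp
  have supp: "P \<in> set_pmf p" "Q \<in> set_pmf p"
    using P Q A \<phi> by (simp_all add: p_def set_pmf_condorcet_model)
  have "0 < \<alpha>" unfolding \<alpha> using supp(1) P1 by (intro measure_pmf_posI) auto
  moreover have "\<alpha> < 1"
  proof -
    have "\<alpha> \<noteq> 1"
      unfolding \<alpha> using supp(2) Q1
      by (auto simp: measure_pmf.prob_eq_1 AE_measure_pmf_iff not_less intro!: bexI[of _ Q])
    then show ?thesis using measure_pmf.prob_le_1[of p] \<alpha> by (simp add: order_less_le)
  qed
  moreover have False
    if ump: "ump_test (profiles A n) (condorcet_model A \<phi> n) (rels_top A a) H1 \<alpha> f" for f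
  proof -
    have "f R = margin_test K1 0 a B1 R"
      if "R \<in> profiles A n" "real_of_int (set_margin R B1 a) \<noteq> K1" for R
      by (rule ump_test_eq_margin_test[OF A \<phi> a B1(1) h1 ump _ \<alpha>_def[symmetric] that]) simp
    from this[OF P] this[OF Q] P1 Q1 have f: "f P = 1" "f Q = 0"
      by (simp_all add: margin_test_def)
    obtain K2 \<Gamma>2 where g: "\<Gamma>2 \<in> {0..1}"
      "test_size (condorcet_model A \<phi> n) (rels_top A a) (margin_test K2 \<Gamma>2 a B2) = \<alpha>"
      using exists_margin_test_of_size[OF A \<phi>(1) a B2(1) \<open>0 < \<alpha>\<close> \<open>\<alpha> < 1\<close>] by blast
    note eq = ump_test_eq_margin_test[OF A \<phi> a B2(1) h2 ump g]
    have "\<not> real_of_int (set_margin P B2 a) < K2"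
    proof
      assume less: "real_of_int (set_margin P B2 a) < K2"
      then have "f P = margin_test K2 \<Gamma>2 a B2 P" by (intro eq[OF P]) simp
      then show False using f(1) less by (simp add: margin_test_def)
    qed
    moreover have "\<not> real_of_int (set_margin Q B2 a) > K2"
    proof
      assume greater: "real_of_int (set_margin Q B2 a) > K2"
      then have "f Q = margin_test K2 \<Gamma>2 a B2 Q" by (intro eq[OF Q]) simp
      then show False using f(2) greater by (simp add: margin_test_def)
    qed
    ultimately show False using margin_less by linarith
  qed
  ultimately show ?thesis by blast
qed


theorem theorem7:
  fixes A :: "'a set" and a :: 'a and n :: nat and \<phi> :: real and H0 H1 :: "'a rel set"
  assumes "finite A" and "card A \<ge> 2" and "n \<ge> 2" and "0 < \<phi>" and "\<phi> < 1"
    and "a \<in> A"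
    and "H0 = rels_top A a"
    and "H1 \<subseteq> binrels A - H0"
  shows "((\<forall>\<alpha>. 0 < \<alpha> \<and> \<alpha> < 1 \<longrightarrow>
            (\<exists>f. ump_test (profiles A n) (condorcet_model A \<phi> n) H0 H1 \<alpha> f)) \<longleftrightarrow>
          (\<exists>B. B \<subseteq> A - {a} \<and> H1 \<subseteq> rels_above A B a))
    \<and> (\<forall>B. B \<subseteq> A - {a} \<and> H1 \<subseteq> rels_above A B a \<longrightarrow>
        (\<forall>\<alpha>. 0 < \<alpha> \<and> \<alpha> < 1 \<longrightarrow>
          (\<exists>K \<Gamma>. \<Gamma> \<in> {0..1} \<and>
             test_size (condorcet_model A \<phi> n) H0 (margin_test K \<Gamma> a B) = \<alpha>) \<and>
          (\<forall>K \<Gamma>. \<Gamma> \<in> {0..1} \<and>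
             test_size (condorcet_model A \<phi> n) H0 (margin_test K \<Gamma> a B) = \<alpha> \<longrightarrow>
             ump_test (profiles A n) (condorcet_model A \<phi> n) H0 H1 \<alpha> (margin_test K \<Gamma> a B))))"
proof -
  let ?ump = "ump_test (profiles A n) (condorcet_model A \<phi> n) H0 H1"
  note [simp] = \<open>H0 = rels_top A a\<close>
  have margin_tests: "(\<exists>K \<Gamma>. \<Gamma> \<in> {0..1} \<and>
        test_size (condorcet_model A \<phi> n) H0 (margin_test K \<Gamma> a B) = \<alpha>) \<and>
      (\<forall>K \<Gamma>. \<Gamma> \<in> {0..1} \<and>
        test_size (condorcet_model A \<phi> n) H0 (margin_test K \<Gamma> a B) = \<alpha> \<longrightarrow>
        ?ump \<alpha> (margin_test K \<Gamma> a B))"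
    if "B \<subseteq> A - {a}" "H1 \<subseteq> rels_above A B a" "0 < \<alpha>" "\<alpha> < 1" for B \<alpha>
    using exists_margin_test_of_size[OF assms(1,4,6) that(1,3,4)]
      margin_test_ump[OF assms(1,4,5,6) that(1,2)] by auto
  have "\<exists>B. B \<subseteq> A - {a} \<and> H1 \<subseteq> rels_above A B a"
    if ex: "\<forall>\<alpha>. 0 < \<alpha> \<and> \<alpha> < 1 \<longrightarrow> (\<exists>f. ?ump \<alpha> f)"
  proof (cases "H1 = {}")
    case False
    then obtain h where h: "h \<in> H1" by blast
    define upper where "upper V = {b \<in> A. (b, a) \<in> V}" for V
    have upper: "V \<in> rels_above A (upper V) a" "upper V \<subseteq> A - {a}" "upper V \<noteq> {}"
      if "V \<in> H1" for V
    proof -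
      have V: "V \<in> binrels A" "V \<notin> rels_top A a"
        using that assms(8) by auto
      then show "V \<in> rels_above A (upper V) a" "upper V \<subseteq> A - {a}"
        using binrels_irrefl[OF V(1)] by (auto simp: rels_above_def upper_def)
      show "upper V \<noteq> {}"
      proof
        assume "upper V = {}"
        then have "(a, b) \<in> V" if "b \<in> A - {a}" for b
          using binrels_swap[OF V(1) _ assms(6), of b] that by (auto simp: upper_def)
        then show False using V by (simp add: rels_top_def)
      qed
    qed
    have "upper V' \<subseteq> upper V" if "V \<in> H1" "V' \<in> H1" for V V'
    proof (rule ccontr)
      assume "\<not> upper V' \<subseteq> upper V"
      from no_ump_of_distinct_upper_sets[OF assms(1,4,5,6,3) upper(2,3)[OF that(1)]
          upper(2)[OF that(2)] this upper(1)[OF that(1)] that(1) upper(1)[OF that(2)] that(2)]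
      show False using ex by auto
    qed
    then have "upper V = upper h" if "V \<in> H1" for V
      using that h by blast
    then have "H1 \<subseteq> rels_above A (upper h) a"
      using upper(1) by (metis subsetI)
    then show ?thesis using upper(2)[OF h] by blast
  qed auto
  then show ?thesis using margin_tests by blast
qed

end
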